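(* Let $M_1=(S_1,r_1)$, $M_2=(S_2,r_2)$ and $M=(S,r)$ be matroids with $S=S_1\times S_2$. The following are equivalent: (i) $r(Y_1\times Y_2)=r_1(Y_1)\cdot r_2(Y_2)$ for all $Y_1\subseteq S_1$ and $Y_2\subseteq S_2$; (ii) $r(\{e_1\}\times Y_2)=r_1(\{e_1\})\cdot r_2(Y_2)$ for all $e_1\in S_1$, $Y_2\subseteq S_2$; $r(Y_1\times\{e_2\})=r_1(Y_1)\cdot r_2(\{e_2\})$ for all $Y_1\subseteq S_1$, $e_2\in S_2$; and $r(S)=r_1(S_1)\cdot r_2(S_2)$; (iii) $M$ is a coupling of $M_1$ and $M_2$ and $r(\{(e_1,e_2)\})=r_1(\{e_1\})\cdot r_2(\{e_2\})$ for every $(e_1,e_2)\in S$.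
   Context: A matroid $M=(S_1\times S_2,r)$ is a coupling of $M_1=(S_1,r_1)$ and $M_2=(S_2,r_2)$ if $r(X_1\times S_2)=r_1(X_1)r_2(S_2)$ for all $X_1\subseteq S_1$ and $r(S_1\times X_2)=r_1(S_1)r_2(X_2)$ for all $X_2\subseteq S_2$. *)

theory Defs
  imports Main
begin

text \<open>
  A matroid is a pair \<open>(S, r)\<close> of a finite ground set and a rank function on its subsets. The
  function \<open>r\<close> is total on \<open>'a set\<close>; its values outside \<open>Pow S\<close> are unconstrained.
\<close>

definition matroid :: "'a set \<Rightarrow> ('a set \<Rightarrow> nat) \<Rightarrow> bool" where
  "matroid S r \<longleftrightarrow>
     finite S \<and>
     (\<forall>X. X \<subseteq> S \<longrightarrow> r X \<le> card X) \<and>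
     (\<forall>X Y. X \<subseteq> Y \<and> Y \<subseteq> S \<longrightarrow> r X \<le> r Y) \<and>
     (\<forall>X Y. X \<subseteq> S \<and> Y \<subseteq> S \<longrightarrow> r (X \<union> Y) + r (X \<inter> Y) \<le> r X + r Y)"

definition coupling ::
  "'a set \<Rightarrow> ('a set \<Rightarrow> nat) \<Rightarrow> 'b set \<Rightarrow> ('b set \<Rightarrow> nat) \<Rightarrow> (('a \<times> 'b) set \<Rightarrow> nat) \<Rightarrow> bool" where
  "coupling S1 r1 S2 r2 r \<longleftrightarrow>
     matroid S1 r1 \<and> matroid S2 r2 \<and> matroid (S1 \<times> S2) r \<and>
     (\<forall>X1. X1 \<subseteq> S1 \<longrightarrow> r (X1 \<times> S2) = r1 X1 * r2 S2) \<and>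
     (\<forall>X2. X2 \<subseteq> S2 \<longrightarrow> r (S1 \<times> X2) = r1 S1 * r2 X2)"

end

theory Submission
  imports Defs
begin

text \<open>
  Two consequences of submodularity drive the proof: closures of parts determine the closure of a
  union, and a family whose union attains the sum of the ranks (a direct sum) stays direct when
  its members shrink. Under (ii), products of spanning sets span, so a product of bases of \<open>M\<^sub>1\<close> and
  \<open>M\<^sub>2\<close> spans \<open>S\<close> and has \<open>r(S)\<close> elements; it is therefore independent, and so is its subset
  \<open>B\<^sub>1 \<times> B\<^sub>2\<close>, where the bases extend bases \<open>B\<^sub>i\<close> of \<open>Y\<^sub>i\<close>; as \<open>B\<^sub>1 \<times> B\<^sub>2\<close> spans \<open>Y\<^sub>1 \<times> Y\<^sub>2\<close>,
  (i) follows. From (iii), the coupling identities say that the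
  fibres over an independent set form a direct sum, in both directions. One direction shows
  \<open>r(X\<^sub>1 \<times> {c}) \<ge> r\<^sub>1(X\<^sub>1)\<close> for each nonloop \<open>c\<close>; summing over a basis of \<open>M\<^sub>2\<close> containing \<open>c\<close>
  forces equality through \<open>r(X\<^sub>1 \<times> S\<^sub>2) = r\<^sub>1(X\<^sub>1) r\<^sub>2(S\<^sub>2)\<close>.
\<close>

section \<open>Submodularity for families of sets\<close>

lemma matroid_finite: "matroid S r \<Longrightarrow> finite S"
  and matroid_le_card: "matroid S r \<Longrightarrow> X \<subseteq> S \<Longrightarrow> r X \<le> card X"
  and matroid_mono: "matroid S r \<Longrightarrow> X \<subseteq> Y \<Longrightarrow> Y \<subseteq> S \<Longrightarrow> r X \<le> r Y"
  and matroid_submod: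
    "matroid S r \<Longrightarrow> X \<subseteq> S \<Longrightarrow> Y \<subseteq> S \<Longrightarrow> r (X \<union> Y) + r (X \<inter> Y) \<le> r X + r Y"
  by (simp_all add: matroid_def)

lemma matroid_empty: "matroid S r \<Longrightarrow> r {} = 0"
  using matroid_le_card[of S r "{}"] by simp

lemma matroid_singleton_cases:
  assumes "matroid S r" "e \<in> S"
  obtains "r {e} = 0" | "r {e} = 1"
  using matroid_le_card[of S r "{e}"] assms by fastforce

text \<open>Diminishing returns, used twice: growing \<open>G\<close> to \<open>F\<close> beside
  \<open>F'\<close> adds at most \<open>r F - r G\<close> to the rank, and growing \<open>G'\<close>
  to \<open>F'\<close> beside \<open>G\<close> adds at most \<open>r F' - r G'\<close>. The additive
  form avoids subtraction on \<open>nat\<close>.\<close>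

lemma matroid_exchange_Un:
  assumes m: "matroid S r" and "G \<subseteq> F" "F \<subseteq> S" "G' \<subseteq> F'" "F' \<subseteq> S"
  shows "r (F \<union> F') + r G + r G' \<le> r (G \<union> G') + r F + r F'"
proof -
  have "r (F \<union> (G \<union> F')) + r (F \<inter> (G \<union> F')) \<le> r F + r (G \<union> F')"
    using assms by (intro matroid_submod[OF m]) auto
  moreover have "r G \<le> r (F \<inter> (G \<union> F'))"
    using assms by (intro matroid_mono[OF m]) auto
  moreover have "r (F' \<union> (G \<union> G')) + r (F' \<inter> (G \<union> G')) \<le> r F' + r (G \<union> G')"
    using assms by (intro matroid_submod[OF m]) auto
  moreover have "r G' \<le> r (F' \<inter> (G \<union> G'))"
    using assms by (intro matroid_mono[OF m]) auto
  moreover have "F \<union> (G \<union> F') = F \<union> F'" "F' \<union> (G \<union> G') = G \<union> F'"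
    using assms by auto
  ultimately show ?thesis by simp
qed

text \<open>Serves both closure and directness: if the ranks of \<open>G i\<close> and
  \<open>F i\<close> agree, the sums cancel; if the family \<open>F\<close> is direct, its union
  cancels against its sum.\<close>

lemma matroid_exchange_UN:
  assumes m: "matroid S r" and "finite A"
    and "\<And>i. i \<in> A \<Longrightarrow> G i \<subseteq> F i" and "\<And>i. i \<in> A \<Longrightarrow> F i \<subseteq> S"
  shows "r (\<Union>i\<in>A. F i) + (\<Sum>i\<in>A. r (G i)) \<le> r (\<Union>i\<in>A. G i) + (\<Sum>i\<in>A. r (F i))"
  using assms(2-4)
proof (induction A rule: finite_induct)
  case (insert a A)
  have "r (F a \<union> (\<Union>i\<in>A. F i)) + r (G a) + r (\<Union>i\<in>A. G i)
      \<le> r (G a \<union> (\<Union>i\<in>A. G i)) + r (F a) + r (\<Union>i\<in>A. F i)"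
    using insert.prems by (intro matroid_exchange_Un[OF m] UN_mono UN_least) auto
  moreover have "r (\<Union>i\<in>A. F i) + (\<Sum>i\<in>A. r (G i)) \<le> r (\<Union>i\<in>A. G i) + (\<Sum>i\<in>A. r (F i))"
    using insert.prems by (intro insert.IH) auto
  ultimately show ?case
    using insert.hyps by simp
qed simp

lemma matroid_UN_le:
  assumes m: "matroid S r" and "finite A" and "\<And>i. i \<in> A \<Longrightarrow> F i \<subseteq> S"
  shows "r (\<Union>i\<in>A. F i) \<le> (\<Sum>i\<in>A. r (F i))"
  \<comment> \<open>Taking the empty set for every \<open>G i\<close> turns the exchange inequality
    into subadditivity.\<close>
  using matroid_exchange_UN[OF m assms(2), of "\<lambda>_. {}" F] assms(3)
  by (simp add: matroid_empty[OF m])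

lemma matroid_direct_sum_mono:
  assumes m: "matroid S r" and "finite A"
    and "\<And>i. i \<in> A \<Longrightarrow> G i \<subseteq> F i" and "\<And>i. i \<in> A \<Longrightarrow> F i \<subseteq> S"
    and "r (\<Union>i\<in>A. F i) = (\<Sum>i\<in>A. r (F i))"
  shows "r (\<Union>i\<in>A. G i) = (\<Sum>i\<in>A. r (G i))"
proof (rule antisym)
  show "r (\<Union>i\<in>A. G i) \<le> (\<Sum>i\<in>A. r (G i))"
    by (rule matroid_UN_le[OF m assms(2)]) (use assms(3,4) in blast)
  show "(\<Sum>i\<in>A. r (G i)) \<le> r (\<Union>i\<in>A. G i)"
    using matroid_exchange_UN[of S r A G F] assms by simp
qed

lemma matroid_span_UN:
  assumes m: "matroid S r" and "finite A"
    and "\<And>i. i \<in> A \<Longrightarrow> G i \<subseteq> F i" and "\<And>i. i \<in> A \<Longrightarrow> F i \<subseteq> S"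
    and "\<And>i. i \<in> A \<Longrightarrow> r (G i) = r (F i)"
  shows "r (\<Union>i\<in>A. G i) = r (\<Union>i\<in>A. F i)"
proof (rule antisym)
  show "r (\<Union>i\<in>A. G i) \<le> r (\<Union>i\<in>A. F i)"
    using assms(3,4) by (intro matroid_mono[OF m] UN_mono UN_least) auto
  show "r (\<Union>i\<in>A. F i) \<le> r (\<Union>i\<in>A. G i)"
    using matroid_exchange_UN[of S r A G F] assms by simp
qed

section \<open>Independent sets and bases\<close>

text \<open>Splitting \<open>I\<close> into \<open>J\<close> and \<open>I - J\<close> gives
  \<open>card I \<le> r J + r (I - J)\<close>, so neither part can fall short of its
  cardinality.\<close>

lemma matroid_indep_subset:
  assumes m: "matroid S r" and "J \<subseteq> I" "I \<subseteq> S" "r I = card I"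
  shows "r J = card J"
proof -
  have fin: "finite I"
    using assms matroid_finite finite_subset by metis
  have "r (J \<union> (I - J)) + r (J \<inter> (I - J)) \<le> r J + r (I - J)"
    using assms by (intro matroid_submod[OF m]) auto
  moreover have "J \<union> (I - J) = I" using assms by auto
  moreover have "r (I - J) \<le> card (I - J)" "r J \<le> card J"
    using assms by (auto intro!: matroid_le_card[OF m])
  moreover have "card (I - J) + card J = card I"
    using fin assms(2) by (metis add.commute card_Diff_subset card_mono finite_subset
        le_add_diff_inverse)
  ultimately show ?thesis using assms(4) by simp
qed

lemma matroid_indep_nonloop:
  assumes "matroid S r" "B \<subseteq> S" "r B = card B" "b \<in> B"
  shows "r {b} = 1"
  using matroid_indep_subset[OF assms(1) _ assms(2,3), of "{b}"] assms(4) by simp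

lemma matroid_extend_to_basis:
  assumes m: "matroid S r" and "I \<subseteq> X" "X \<subseteq> S" "r I = card I"
  obtains B where "I \<subseteq> B" "B \<subseteq> X" "r B = card B" "r B = r X"
proof -
  have finX: "finite X"
    using assms matroid_finite finite_subset by metis
  let ?P = "\<lambda>B. I \<subseteq> B \<and> B \<subseteq> X \<and> r B = card B"
  have "finite {B. ?P B}"
    by (rule finite_subset[of _ "Pow X"]) (use finX in auto)
  moreover have "{B. ?P B} \<noteq> {}" using assms by auto
  ultimately obtain B where "B \<in> {B. ?P B}" and "\<forall>C\<in>{B. ?P B}. B \<subseteq> C \<longrightarrow> B = C"
    by (meson finite_has_maximal)
  then have B: "?P B" and max: "\<And>C. ?P C \<Longrightarrow> B \<subseteq> C \<Longrightarrow> B = C"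
    by simp_all
  have finB: "finite B" using B finX finite_subset by blast
  \<comment> \<open>Maximality excludes rank \<open>Suc (card B)\<close>, so every element of
    \<open>X\<close> lies in the closure of \<open>B\<close>.\<close>
  have "r (insert x B) = r B" if x: "x \<in> X" for x
  proof (cases "x \<in> B")
    case False
    then have "r (insert x B) \<noteq> Suc (card B)"
      using max[of "insert x B"] B x finB by auto
    moreover have "r (insert x B) \<le> Suc (card B)"
      using matroid_le_card[OF m, of "insert x B"] x B assms(3) finB False by auto
    moreover have "r B \<le> r (insert x B)"
      using x B assms(3) by (intro matroid_mono[OF m]) auto
    ultimately show ?thesis using B by auto
  qed (simp add: insert_absorb)
  \<comment> \<open>Comparing the constant family \<open>B\<close> with the sets
    \<open>insert x B\<close> passes from single elements to all of \<open>X\<close> at once. If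
    \<open>X\<close> is empty, so is \<open>B\<close>, and both unions still have the intended
    values.\<close>
  then have "r (\<Union>x\<in>X. B) = r (\<Union>x\<in>X. insert x B)"
    using B assms(3) by (subst matroid_span_UN[OF m finX, of _ "\<lambda>x. insert x B"]) auto
  moreover have "(\<Union>x\<in>X. insert x B) = X" "(\<Union>x\<in>X. B) = B"
    using B by auto
  ultimately show thesis using that B by metis
qed

lemma matroid_basis:
  assumes "matroid S r" "X \<subseteq> S"
  obtains B where "B \<subseteq> X" "r B = card B" "r B = r X"
  using matroid_extend_to_basis[OF assms(1) empty_subsetI assms(2)] matroid_empty[OF assms(1)]
  by (metis card.empty)

section \<open>Products and the exchange of factors\<close>

lemma times_eq_UN_left: "A \<times> B = (\<Union>a\<in>A. {a} \<times> B)"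
  and times_eq_UN_right: "A \<times> B = (\<Union>b\<in>B. A \<times> {b})"
  by auto

text \<open>Lets the rank of lines be computed in one direction only; the other direction follows by
  exchanging the factors.\<close>

lemma matroid_swap:
  assumes m: "matroid (S1 \<times> S2) r"
  shows "matroid (S2 \<times> S1) (\<lambda>Z. r (prod.swap ` Z))"
proof -
  have sub: "prod.swap ` Z \<subseteq> S1 \<times> S2" if "Z \<subseteq> S2 \<times> S1" for Z
    using that by auto
  have card: "card (prod.swap ` Z) = card Z" for Z :: "('b \<times> 'a) set"
    by (intro card_image inj_swap)
  have "finite (S2 \<times> S1)"
    using matroid_finite[OF m] by (metis finite_imageI product_swap)
  then show ?thesis
    unfolding matroid_def image_Un image_Int[OF inj_swap]
    using matroid_le_card[OF m sub] matroid_mono[OF m image_mono sub]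
      matroid_submod[OF m sub sub] by (simp add: card)
qed

lemma coupling_swap:
  assumes "coupling S1 r1 S2 r2 r"
  shows "coupling S2 r2 S1 r1 (\<lambda>Z. r (prod.swap ` Z))"
  using assms matroid_swap[of S1 S2 r]
  by (simp add: coupling_def product_swap mult.commute)

section \<open>Rank formulas on products\<close>

lemma product_rank_of_lines:
  assumes m1: "matroid S1 r1" and m2: "matroid S2 r2" and m: "matroid (S1 \<times> S2) r"
    and left: "\<And>e1 Y2. e1 \<in> S1 \<Longrightarrow> Y2 \<subseteq> S2 \<Longrightarrow> r ({e1} \<times> Y2) = r1 {e1} * r2 Y2"
    and right: "\<And>Y1 e2. Y1 \<subseteq> S1 \<Longrightarrow> e2 \<in> S2 \<Longrightarrow> r (Y1 \<times> {e2}) = r1 Y1 * r2 {e2}"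
    and full: "r (S1 \<times> S2) = r1 S1 * r2 S2"
    and Y1: "Y1 \<subseteq> S1" and Y2: "Y2 \<subseteq> S2"
  shows "r (Y1 \<times> Y2) = r1 Y1 * r2 Y2"
proof -
  \<comment> \<open>Each fibre of \<open>X1 \<times> B\<close> spans the matching fibre of
    \<open>X1 \<times> X2\<close>, hence so does the union.\<close>
  have span_left: "r (X1 \<times> B) = r (X1 \<times> X2)"
    if "X1 \<subseteq> S1" "B \<subseteq> X2" "X2 \<subseteq> S2" "r2 B = r2 X2" for X1 B X2
    unfolding times_eq_UN_left[of X1]
  proof (rule matroid_span_UN[OF m])
    show "finite X1" using that matroid_finite[OF m1] finite_subset by blast
    show "r ({i} \<times> B) = r ({i} \<times> X2)" if "i \<in> X1" for i
    proof -
      have "i \<in> S1" "B \<subseteq> S2" using that \<open>X1 \<subseteq> S1\<close> \<open>B \<subseteq> X2\<close> \<open>X2 \<subseteq> S2\<close> by auto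
      then show ?thesis using left \<open>X2 \<subseteq> S2\<close> \<open>r2 B = r2 X2\<close> by simp
    qed
  qed (use that in auto)
  have span_right: "r (B \<times> X2) = r (X1 \<times> X2)"
    if "X2 \<subseteq> S2" "B \<subseteq> X1" "X1 \<subseteq> S1" "r1 B = r1 X1" for X1 B X2
    unfolding times_eq_UN_right[of _ X2]
  proof (rule matroid_span_UN[OF m])
    show "finite X2" using that matroid_finite[OF m2] finite_subset by blast
    show "r (B \<times> {i}) = r (X1 \<times> {i})" if "i \<in> X2" for i
    proof -
      have "i \<in> S2" "B \<subseteq> S1" using that \<open>X2 \<subseteq> S2\<close> \<open>B \<subseteq> X1\<close> \<open>X1 \<subseteq> S1\<close> by auto
      then show ?thesis using right \<open>X1 \<subseteq> S1\<close> \<open>r1 B = r1 X1\<close> by simp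
    qed
  qed (use that in auto)
  obtain B1 where B1: "B1 \<subseteq> Y1" "r1 B1 = card B1" "r1 B1 = r1 Y1"
    using matroid_basis[OF m1 Y1] by blast
  obtain B2 where B2: "B2 \<subseteq> Y2" "r2 B2 = card B2" "r2 B2 = r2 Y2"
    using matroid_basis[OF m2 Y2] by blast
  obtain C1 where C1: "B1 \<subseteq> C1" "C1 \<subseteq> S1" "r1 C1 = card C1" "r1 C1 = r1 S1"
    using matroid_extend_to_basis[OF m1 _ subset_refl B1(2)] B1(1) Y1 by blast
  obtain C2 where C2: "B2 \<subseteq> C2" "C2 \<subseteq> S2" "r2 C2 = card C2" "r2 C2 = r2 S2"
    using matroid_extend_to_basis[OF m2 _ subset_refl B2(2)] B2(1) Y2 by blast
  \<comment> \<open>Enlarging \<open>C2\<close> to \<open>S2\<close> and then \<open>C1\<close> to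
    \<open>S1\<close> keeps the rank, and \<open>full\<close> evaluates it as
    \<open>card C1 * card C2\<close>.\<close>
  have "r (C1 \<times> C2) = card (C1 \<times> C2)"
    using span_left[OF C1(2) C2(2) subset_refl C2(4)]
      span_right[OF subset_refl C1(2) subset_refl C1(4)] full C1 C2
    by (simp add: card_cartesian_product)
  then have "r (B1 \<times> B2) = card (B1 \<times> B2)"
    using C1 C2 by (subst matroid_indep_subset[OF m, of _ "C1 \<times> C2"]) auto
  moreover have "r (B1 \<times> B2) = r (B1 \<times> Y2)"
    using span_left[of B1 B2 Y2] B1(1) B2 Y1 Y2 by auto
  moreover have "r (B1 \<times> Y2) = r (Y1 \<times> Y2)"
    using span_right[of Y2 B1 Y1] B1 Y1 Y2 by auto
  ultimately show ?thesis
    using B1 B2 by (simp add: card_cartesian_product)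
qed

lemma coupling_line_rank:
  assumes c: "coupling S1 r1 S2 r2 r"
    and pt: "\<And>e1 e2. e1 \<in> S1 \<Longrightarrow> e2 \<in> S2 \<Longrightarrow> r {(e1, e2)} = r1 {e1} * r2 {e2}"
    and X: "X \<subseteq> S1" and e: "e \<in> S2"
  shows "r (X \<times> {e}) = r1 X * r2 {e}"
proof -
  have m1: "matroid S1 r1" and m2: "matroid S2 r2" and m: "matroid (S1 \<times> S2) r"
    and cp1: "\<And>X1. X1 \<subseteq> S1 \<Longrightarrow> r (X1 \<times> S2) = r1 X1 * r2 S2"
    and cp2: "\<And>X2. X2 \<subseteq> S2 \<Longrightarrow> r (S1 \<times> X2) = r1 S1 * r2 X2"
    using c by (auto simp: coupling_def)
  obtain I where I: "I \<subseteq> X" "r1 I = card I" "r1 I = r1 X"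
    using matroid_basis[OF m1 X] by blast
  have IS: "I \<subseteq> S1" and finI: "finite I"
    using I X matroid_finite[OF m1] finite_subset by (blast, metis subset_trans)
  have nonloop: "r1 {b} = 1" if "b \<in> I" for b
    using matroid_indep_nonloop[OF m1 IS I(2) that] .
  have ge: "r1 X \<le> r (X \<times> {d})" if d: "d \<in> S2" "r2 {d} = 1" for d
  proof -
    \<comment> \<open>Independence of \<open>I\<close> makes \<open>r (I \<times> S2)\<close> equal
      to \<open>card I\<close> copies of \<open>r2 S2\<close>, so the fibres form a direct sum;
      shrinking each to one point keeps it direct.\<close>
    have "r (\<Union>b\<in>I. {b} \<times> S2) = (\<Sum>b\<in>I. r ({b} \<times> S2))"
    proof -
      have "r ({b} \<times> S2) = r2 S2" if "b \<in> I" for b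
        using cp1[of "{b}"] nonloop[OF that] that IS by auto
      then show ?thesis
        using cp1[OF IS] I(2) by (simp flip: times_eq_UN_left)
    qed
    then have "r (\<Union>b\<in>I. {b} \<times> {d}) = (\<Sum>b\<in>I. r ({b} \<times> {d}))"
      using d IS by (subst matroid_direct_sum_mono[OF m finI, of _ "\<lambda>b. {b} \<times> S2"]) auto
    also have "\<dots> = (\<Sum>b\<in>I. 1)"
      using pt d IS nonloop by (intro sum.cong) auto
    finally have "r (I \<times> {d}) = r1 X"
      using I by (simp add: times_eq_UN_left[of I "{d}"])
    then show ?thesis
      using matroid_mono[OF m, of "I \<times> {d}" "X \<times> {d}"] I(1) X d by auto
  qed
  show ?thesis
    using m2 e
  proof (cases rule: matroid_singleton_cases)
    case 1
    have "r (X \<times> {e}) \<le> r (S1 \<times> {e})"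
      using X e by (intro matroid_mono[OF m]) auto
    also have "\<dots> = 0" using cp2[of "{e}"] e 1 by simp
    finally show ?thesis using 1 by simp
  next
    case 2
    \<comment> \<open>The basis must contain \<open>e\<close> so that \<open>X \<times> {e}\<close>
      is one of the summands.\<close>
    obtain B where B: "{e} \<subseteq> B" "B \<subseteq> S2" "r2 B = card B" "r2 B = r2 S2"
      using matroid_extend_to_basis[OF m2 _ subset_refl, of "{e}"] e 2 by auto
    have finB: "finite B" using B(2) matroid_finite[OF m2] finite_subset by blast
    have nl: "r2 {d} = 1" if "d \<in> B" for d
      using matroid_indep_nonloop[OF m2 B(2,3) that] .
    have "r (\<Union>d\<in>B. S1 \<times> {d}) = (\<Sum>d\<in>B. r (S1 \<times> {d}))"
    proof -
      have "r (S1 \<times> {d}) = r1 S1" if "d \<in> B" for d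
        using cp2[of "{d}"] nl[OF that] that B(2) by auto
      then show ?thesis
        using cp2[OF B(2)] B(3) by (simp flip: times_eq_UN_right)
    qed
    then have "r (\<Union>d\<in>B. X \<times> {d}) = (\<Sum>d\<in>B. r (X \<times> {d}))"
      using X B(2) by (subst matroid_direct_sum_mono[OF m finB, of _ "\<lambda>d. S1 \<times> {d}"]) auto
    moreover have "r (X \<times> B) \<le> r (X \<times> S2)"
      using X B(2) by (intro matroid_mono[OF m]) auto
    ultimately have "(\<Sum>d\<in>B. r (X \<times> {d})) \<le> (\<Sum>d\<in>B. r1 X)"
      using cp1[OF X] B by (simp add: mult.commute flip: times_eq_UN_right)
    moreover have "r1 X \<le> r (X \<times> {d})" if "d \<in> B" for d
      using ge nl[OF that] that B(2) by blast
    \<comment> \<open>Every summand is at least \<open>r1 X\<close> while their sum is at most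
      \<open>card B\<close> times \<open>r1 X\<close>, so none can exceed it.\<close>
    ultimately have "\<not> r1 X < r (X \<times> {e})"
      using sum_strict_mono_ex1[OF finB, of "\<lambda>_. r1 X" "\<lambda>d. r (X \<times> {d})"] B(1)
      by (meson insert_subset not_less)
    then show ?thesis
      using ge[OF e 2] 2 by simp
  qed
qed

theorem theorem3p8:
  fixes S1 :: "'a set" and S2 :: "'b set" and S :: "('a \<times> 'b) set"
    and r1 :: "'a set \<Rightarrow> nat" and r2 :: "'b set \<Rightarrow> nat" and r :: "('a \<times> 'b) set \<Rightarrow> nat"
  assumes "matroid S1 r1" and "matroid S2 r2" and "matroid S r" and "S = S1 \<times> S2"
  defines "i \<equiv> (\<forall>Y1 Y2. Y1 \<subseteq> S1 \<and> Y2 \<subseteq> S2 \<longrightarrow> r (Y1 \<times> Y2) = r1 Y1 * r2 Y2)"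
    and "ii \<equiv> (\<forall>e1 Y2. e1 \<in> S1 \<and> Y2 \<subseteq> S2 \<longrightarrow> r ({e1} \<times> Y2) = r1 {e1} * r2 Y2) \<and>
              (\<forall>Y1 e2. Y1 \<subseteq> S1 \<and> e2 \<in> S2 \<longrightarrow> r (Y1 \<times> {e2}) = r1 Y1 * r2 {e2}) \<and>
              r S = r1 S1 * r2 S2"
    and "iii \<equiv> coupling S1 r1 S2 r2 r \<and>
              (\<forall>e1 e2. (e1, e2) \<in> S \<longrightarrow> r {(e1, e2)} = r1 {e1} * r2 {e2})"
  shows "(i \<longleftrightarrow> ii) \<and> (ii \<longleftrightarrow> iii)"
proof -
  note m = assms(3)[unfolded assms(4)]
  have i_ii: ii if i
    using that by (auto simp: i_def ii_def assms(4))
  have ii_i: i if ii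
    unfolding i_def
    using product_rank_of_lines[OF assms(1,2) m] that by (auto simp: ii_def assms(4))
  have i_iii: iii if i
  proof -
    have "r {(e1, e2)} = r1 {e1} * r2 {e2}" if "e1 \<in> S1" "e2 \<in> S2" for e1 e2
      using \<open>i\<close>[unfolded i_def, rule_format, of "{e1}" "{e2}"] that by simp
    then show ?thesis
      using that assms(1,2) m by (auto simp: i_def iii_def coupling_def assms(4))
  qed
  have iii_ii: ii if iii
  proof -
    have c: "coupling S1 r1 S2 r2 r"
      and pt: "\<And>e1 e2. e1 \<in> S1 \<Longrightarrow> e2 \<in> S2 \<Longrightarrow> r {(e1, e2)} = r1 {e1} * r2 {e2}"
      using that by (auto simp: iii_def assms(4))
    have "r ({e1} \<times> Y2) = r1 {e1} * r2 Y2" if "e1 \<in> S1" "Y2 \<subseteq> S2" for e1 Y2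
      \<comment> \<open>In the exchanged coupling \<open>{e1} \<times> Y2\<close> becomes the line
        \<open>Y2 \<times> {e1}\<close>.\<close>
      using coupling_line_rank[OF coupling_swap[OF c] _ that(2,1)] pt
      by (simp add: product_swap mult.commute)
    moreover have "r (S1 \<times> S2) = r1 S1 * r2 S2"
      using c by (auto simp: coupling_def)
    ultimately show ?thesis
      using coupling_line_rank[OF c pt] by (auto simp: ii_def assms(4))
  qed
  show ?thesis
    using i_ii ii_i i_iii iii_ii by blast
qed

end
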